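(* Let $m \equiv 0 \pmod{4}$ be a positive integer, and let $e$ be an integer with $2 \leq e \leq \lfloor m/2\rfloor$ and $\gcd(m,e)=2$. Let $\alpha$ be a generator of $\mathbb{F}_{2^m}^*$, let $\mathcal{C}_E$ be the binary cyclic code of length $2^m-1$ with generator polynomial $\operatorname{lcm}\big(\mathbb{M}_{\alpha}(x),\mathbb{M}_{\alpha^{1+2^e}}(x)\big)$, and let $\overline{\mathcal{C}_E}$ be its extended code, with coordinates indexed by $V=\{0,1,\dots,2^m-1\}$. Then the supports of the codewords of Hamming weight $8$ in $\overline{\mathcal{C}_E}$ form a $2$-$(2^m,8,\lambda)$ design on $V$ with $$\lambda=\frac{2^{4m-4}-27\cdot 2^{3m-4}+23\cdot 2^{2m-1}+261\cdot 2^{m-2}+403}{45}.$$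
   Context: $\mathbb{M}_{\beta}(x)$ denotes the minimal polynomial of $\beta\in\mathbb{F}_{2^m}$ over $\mathbb{F}_2$. A binary cyclic code of length $n$ with generator polynomial $g(x)$ is the ideal generated by $g(x)$ in $\mathbb{F}_2[x]/(x^n-1)$, identified with vectors in $\mathbb{F}_2^n$. The extended code is obtained by appending an overall parity-check coordinate (sum of all coordinates) to each codeword. The support of a codeword is the set of coordinates where it is nonzero. A $2$-$(v,k,\lambda)$ design is a pair $(V,\mathcal{B})$ with $|V|=v$ and $\mathcal{B}$ a set of $k$-subsets of $V$ such that every $2$-subset of $V$ is contained in exactly $\lambda$ members of $\mathcal{B}$. *)

theory Defs
  imports
    Complex_Main
    "HOL-Library.Z2"
    "HOL-Library.Cardinality"
    "HOL-Number_Theory.Cong"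
    "HOL-Computational_Algebra.Computational_Algebra"
    "HOL-Computational_Algebra.Field_as_Ring"
begin

text \<open>
  The field with two elements is the type \<^typ>\<open>bit\<close>. The following instances, set up as for the
  other fields in \<^theory>\<open>HOL-Computational_Algebra.Field_as_Ring\<close>, are what makes the library's
  \<^const>\<open>lcm\<close> (normalised to be monic) available on \<^typ>\<open>bit poly\<close>.
\<close>

instantiation bit ::
  "{unique_euclidean_ring, normalization_euclidean_semiring, normalization_semidom_multiplicative}"
begin

definition [simp]: "normalize_bit = (normalize_field :: bit \<Rightarrow> _)"
definition [simp]: "unit_factor_bit = (unit_factor_field :: bit \<Rightarrow> _)"
definition [simp]: "euclidean_size_bit = (euclidean_size_field :: bit \<Rightarrow> _)"
definition [simp]: "division_segment (x :: bit) = 1"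

instance
  by standard
    (simp_all add: dvd_field_iff field_split_simps split: if_splits)

end

instantiation bit :: euclidean_ring_gcd
begin

definition gcd_bit :: "bit \<Rightarrow> bit \<Rightarrow> bit" where
  "gcd_bit = Euclidean_Algorithm.gcd"
definition lcm_bit :: "bit \<Rightarrow> bit \<Rightarrow> bit" where
  "lcm_bit = Euclidean_Algorithm.lcm"
definition Gcd_bit :: "bit set \<Rightarrow> bit" where
  "Gcd_bit = Euclidean_Algorithm.Gcd"
definition Lcm_bit :: "bit set \<Rightarrow> bit" where
  "Lcm_bit = Euclidean_Algorithm.Lcm"

instance by standard (simp_all add: gcd_bit_def lcm_bit_def Gcd_bit_def Lcm_bit_def)

end

instance bit :: field_gcd ..

text \<open>
  In characteristic 2, \<^const>\<open>of_bool\<close> applied to \<open>odd\<close>, abbreviated \<open>of_bit\<close>, is the embedding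
  of the prime field.
\<close>

definition min_poly2 :: "'a::field \<Rightarrow> bit poly" where
  "min_poly2 \<beta> = (THE p. lead_coeff p = 1 \<and> poly (map_poly of_bit p) \<beta> = 0 \<and>
     (\<forall>q. q \<noteq> 0 \<and> poly (map_poly of_bit q) \<beta> = 0 \<longrightarrow> degree p \<le> degree q))"

text \<open>
  A vector \<open>[c\<^sub>0, \<dots>, c\<^sub>n\<^sub>-\<^sub>1]\<close> stands for the residue class of
  \<open>c\<^sub>0 + c\<^sub>1 x + \<dots> + c\<^sub>n\<^sub>-\<^sub>1 x\<^sup>n\<^sup>-\<^sup>1\<close> modulo \<open>x\<^sup>n - 1\<close>; the code is the principal ideal
  of the class of \<open>g\<close>.
\<close>

definition cyclic_code :: "nat \<Rightarrow> bit poly \<Rightarrow> bit list set" where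
  "cyclic_code n g = {c. length c = n \<and> (\<exists>a. [Poly c = a * g] (mod (monom 1 n - 1)))}"

definition extended_code :: "bit list set \<Rightarrow> bit list set" where
  "extended_code C = (\<lambda>c. c @ [sum_list c]) ` C"

definition support :: "bit list \<Rightarrow> nat set" where
  "support c = {i. i < length c \<and> c ! i \<noteq> 0}"

definition hamming_weight :: "bit list \<Rightarrow> nat" where
  "hamming_weight c = card (support c)"

definition two_design :: "'v set \<Rightarrow> 'v set set \<Rightarrow> nat \<Rightarrow> nat \<Rightarrow> nat \<Rightarrow> bool" where
  "two_design V B v k l \<longleftrightarrow>
     finite V \<and> card V = v \<and> (\<forall>b\<in>B. b \<subseteq> V \<and> card b = k) \<and>
     (\<forall>T. T \<subseteq> V \<and> card T = 2 \<longrightarrow> card {b \<in> B. T \<subseteq> b} = l)"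

end

theory Submission
  imports Defs
begin

text \<open>
  Write \<open>q = 2\<^sup>m\<close> and \<open>Q = 2\<^sup>e\<close>. Indexing the coordinates by the points of the field, with the
  parity coordinate at \<open>0\<close>, the words of the extended code are the sets \<open>T\<close> of even size
  with \<open>\<Sum>x = \<Sum>x\<^bsup>1+Q\<^esup> = 0\<close> over \<open>x \<in> T\<close>. This family is invariant under the affine group, which is
  doubly transitive, so every weight class is a 2-design and \<open>\<lambda>\<close> follows from the number of words
  of weight 8.

  By orthogonality of characters, the number of words of weight \<open>k\<close> is \<open>1/q\<^sup>2\<close> times the sum of the
  \<open>k\<close>-th Krawtchouk polynomial over all character sums \<open>S(a,b) = \<Sum>\<chi>(a x\<^bsup>1+Q\<^esup> + b x)\<close>, so that only the
  moments of order 2, 4, 6 and 8 are needed for weight 8. The square of \<open>S(a,b)\<close> is either \<open>0\<close> or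
  \<open>q r\<^sub>a\<close>, where \<open>r\<^sub>a\<close> is the size of the radical \<open>{u. a\<^sup>Q u\<^bsup>Q\<^sup>2\<^esup> = a u}\<close>, and by Parseval the squares
  add up to \<open>q\<^sup>2\<close> over \<open>b\<close>. For \<open>a \<noteq> 0\<close> the radical has 1 or 16 elements; counting the pairs
  \<open>(a,u)\<close> in two ways shows that 16 occurs for exactly \<open>(q-1)/5\<close> values of \<open>a\<close>.
\<close>

section \<open>Finite fields\<close>

lemma gcd_power_minus_one_nat:
  fixes b :: nat
  assumes "b > 0"
  shows "gcd (b ^ m - 1) (b ^ n - 1) = b ^ gcd m n - 1"
proof (induction m n rule: gcd_nat_induct)
  case (step m n)
  have "[b ^ n = 1] (mod (b ^ n - 1))"
    using assms by (simp add: cong_altdef_nat)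
  then have "[(b ^ n) ^ (m div n) * b ^ (m mod n) = 1 ^ (m div n) * b ^ (m mod n)] (mod b ^ n - 1)"
    by (intro cong_mult cong_pow cong_refl)
  then have "[b ^ m = b ^ (m mod n)] (mod (b ^ n - 1))"
    by (simp flip: power_mult power_add)
  then have "[b ^ m - 1 = b ^ (m mod n) - 1] (mod (b ^ n - 1))"
    using assms by (intro cong_diff_nat cong_refl) simp_all
  then have "gcd (b ^ m - 1) (b ^ n - 1) = gcd (b ^ (m mod n) - 1) (b ^ n - 1)"
    by (rule cong_gcd_eq)
  also have "\<dots> = b ^ gcd m n - 1"
    using step by (simp add: gcd.commute flip: gcd_red_nat)
  finally show ?case .
qed simp

lemma power_gcd_eq_1_iff:
  fixes x :: "'a::monoid_mult"
  shows "x ^ gcd a b = 1 \<longleftrightarrow> x ^ a = 1 \<and> x ^ b = 1"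
proof (cases "a = 0")
  case False
  have "x ^ (k * l) = 1" if "x ^ k = 1" for k l
    using that by (simp add: power_mult)
  moreover obtain i j where "a * i = b * j + gcd a b"
    using bezout_nat[OF False] by blast
  then have "x ^ (a * i) = x ^ (b * j) * x ^ gcd a b"
    by (simp add: power_add)
  ultimately show ?thesis
    by (metis dvd_def gcd_dvd1 gcd_dvd2 mult_1)
qed simp

lemma one_less_CARD_field: "CARD('a::{field,finite}) > 1"
  using card_mono[of UNIV "{0, 1 :: 'a}"] by simp

lemma power_CARD_minus_one:
  fixes x :: "'a::{field,finite}"
  assumes "x \<noteq> 0"
  shows "x ^ (CARD('a) - 1) = 1"
proof -
  have "(\<Prod>y\<in>UNIV-{0}. x * y) = (\<Prod>y\<in>UNIV-{0}. y)"
    by (rule prod.reindex_bij_witness[of _ "\<lambda>y. y / x" "\<lambda>y. x * y"]) (use assms in auto)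
  then have "x ^ (CARD('a) - 1) * (\<Prod>y\<in>UNIV-{0::'a}. y) = (\<Prod>y\<in>UNIV-{0}. y)"
    by (simp add: prod.distrib card_Diff_singleton)
  then show ?thesis
    by simp
qed

lemma card_roots_of_unity_le:
  fixes d :: nat
  assumes "d > 0"
  shows "card {x::'a::idom. x ^ d = 1} \<le> d"
proof -
  let ?p = "monom 1 d - 1 :: 'a poly"
  have "coeff ?p d = 1"
    using assms by simp
  then have "?p \<noteq> 0"
    by (metis coeff_0 zero_neq_one)
  then have "card {x. poly ?p x = 0} \<le> degree ?p"
    by (rule card_poly_roots_bound)
  also have "\<dots> \<le> d"
    by (intro degree_diff_le) (simp_all add: degree_monom_eq)
  finally show ?thesis
    by (simp add: poly_monom)
qed

lemma card_roots_geometric_sum_le: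
  fixes d k :: nat
  assumes "d > 0" and "k > 0"
  shows "card {x::'a::idom. (\<Sum>i<k. (x ^ d) ^ i) = 0} \<le> d * (k - 1)"
proof -
  let ?p = "\<Sum>i<k. monom (1::'a) (d * i)"
  have "poly ?p 0 = (\<Sum>i<k. if i = 0 then 1 else 0)"
    unfolding poly_sum using assms by (intro sum.cong) (auto simp: poly_monom power_0_left)
  then have "?p \<noteq> 0"
    using assms by auto
  then have "card {x. poly ?p x = 0} \<le> degree ?p"
    by (rule card_poly_roots_bound)
  also have "\<dots> \<le> d * (k - 1)"
    by (intro degree_sum_le) (auto simp: degree_monom_eq)
  finally show ?thesis
    by (simp add: poly_sum poly_monom power_mult)
qed

text \<open>
  With \<open>n = |F| - 1 = d k\<close>, all \<open>n\<close> units are roots of \<open>x\<^sup>n - 1 = (x\<^sup>d - 1) (1 + x\<^sup>d + \<dots> + x\<^bsup>d(k-1)\<^esup>)\<close>,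
  and the second factor has at most \<open>n - d\<close> of them.
\<close>

lemma card_roots_of_unity_dvd:
  assumes "d dvd CARD('a) - 1"
  shows "card {x::'a::{field,finite}. x ^ d = 1} = d"
proof -
  let ?n = "CARD('a) - 1"
  obtain k where k: "?n = d * k"
    using assms by blast
  with one_less_CARD_field[where ?'a = 'a] have pos: "d > 0" "k > 0"
    by (cases "d = 0"; cases "k = 0"; simp)+
  let ?R = "{x::'a. x ^ d = 1}" and ?G = "{x::'a. (\<Sum>i<k. (x ^ d) ^ i) = 0}"
  have "x ^ d = 1 \<or> (\<Sum>i<k. (x ^ d) ^ i) = 0" if "x \<noteq> 0" for x :: 'a
  proof -
    have "(x ^ d - 1) * (\<Sum>i<k. (x ^ d) ^ i) = x ^ ?n - 1"
      by (simp only: power_diff_1_eq[of "x ^ d" k, symmetric] power_mult k)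
    then show ?thesis
      using power_CARD_minus_one[OF that] by simp
  qed
  then have "UNIV - {0} \<subseteq> ?R \<union> ?G"
    by blast
  then have "card (UNIV - {0::'a}) \<le> card (?R \<union> ?G)"
    by (intro card_mono) simp_all
  also have "\<dots> \<le> card ?R + card ?G"
    by (rule card_Un_le)
  finally have "d * k \<le> card ?R + card ?G"
    by (simp add: card_Diff_singleton flip: k)
  moreover have "card ?G \<le> d * (k - 1)"
    using pos by (rule card_roots_geometric_sum_le)
  moreover have "d * k = d + d * (k - 1)"
    using pos by (simp add: algebra_simps)
  ultimately show ?thesis
    using card_roots_of_unity_le[OF pos(1), where ?'a = 'a] by linarith
qed

lemma card_roots_of_unity:
  assumes "d > 0"
  shows "card {x::'a::{field,finite}. x ^ d = 1} = gcd d (CARD('a) - 1)"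
proof -
  have "x ^ d = 1 \<longleftrightarrow> x ^ gcd d (CARD('a) - 1) = 1" for x :: 'a
    using assms power_CARD_minus_one[of x] unfolding power_gcd_eq_1_iff
    by (cases "x = 0") (auto simp: power_0_left)
  then show ?thesis
    by (simp add: card_roots_of_unity_dvd)
qed

lemma card_power_fibre:
  fixes y :: "'a::{field,finite}"
  assumes "y \<noteq> 0" and "d > 0"
  shows "card {x. x ^ d = y ^ d} = gcd d (CARD('a) - 1)"
proof -
  have "bij_betw (\<lambda>x. y * x) {x. x ^ d = 1} {x. x ^ d = y ^ d}"
    by (rule bij_betw_byWitness[where f' = "\<lambda>x. x / y"])
      (use assms(1) in \<open>auto simp: power_mult_distrib power_divide\<close>)
  then show ?thesis
    using card_roots_of_unity[OF assms(2), where ?'a = 'a] by (simp add: bij_betw_same_card)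
qed

section \<open>Fields of characteristic two and their additive characters\<close>

lemma sum_character_subgroup:
  fixes \<phi> :: "'a::ab_group_add \<Rightarrow> 'b::idom"
  assumes hom: "\<And>x y. x \<in> H \<Longrightarrow> y \<in> H \<Longrightarrow> \<phi> (x + y) = \<phi> x * \<phi> y"
    and closed: "\<And>x y. x \<in> H \<Longrightarrow> y \<in> H \<Longrightarrow> x + y \<in> H" "\<And>x. x \<in> H \<Longrightarrow> - x \<in> H"
  shows "sum \<phi> H = 0 \<or> (\<forall>x\<in>H. \<phi> x = 1)"
proof (rule disjCI)
  assume "\<not> (\<forall>x\<in>H. \<phi> x = 1)"
  then obtain z where z: "z \<in> H" "\<phi> z \<noteq> 1"
    by blast
  have "sum \<phi> H = (\<Sum>x\<in>H. \<phi> (z + x))"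
    by (rule sum.reindex_bij_witness[of _ "\<lambda>x. z + x" "\<lambda>x. - z + x"])
      (use z closed in \<open>auto simp: add.assoc[symmetric]
        simp del: add_uminus_conv_diff uminus_add_conv_diff\<close>)
  also have "\<dots> = \<phi> z * sum \<phi> H"
    using z by (simp add: hom sum_distrib_left)
  finally show "sum \<phi> H = 0"
    using z by simp
qed

lemma sum_square_shift:
  fixes f :: "'a::{ab_group_add,finite} \<Rightarrow> 'b::comm_semiring_1"
  shows "(\<Sum>x\<in>UNIV. f x)\<^sup>2 = (\<Sum>u\<in>UNIV. \<Sum>x\<in>UNIV. f x * f (u + x))"
proof -
  have "(\<Sum>y\<in>UNIV. f x * f y) = (\<Sum>u\<in>UNIV. f x * f (u + x))" for x
    by (rule sum.reindex_bij_witness[of _ "\<lambda>u. u + x" "\<lambda>y. y - x"]) simp_all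
  then have "(\<Sum>x\<in>UNIV. f x)\<^sup>2 = (\<Sum>x\<in>UNIV. \<Sum>u\<in>UNIV. f x * f (u + x))"
    by (simp only: power2_eq_square sum_product)
  also have "\<dots> = (\<Sum>u\<in>UNIV. \<Sum>x\<in>UNIV. f x * f (u + x))"
    by (rule sum.swap)
  finally show ?thesis .
qed

locale binary_field =
  fixes m :: nat and field_type :: "'a::{field,finite} itself"
  assumes CARD_eq: "CARD('a) = 2 ^ m"
begin

lemma m_pos: "m > 0"
  using one_less_CARD_field[where ?'a = 'a] CARD_eq by (cases m) simp_all

lemma power_two_power_m_minus_one: "x \<noteq> 0 \<Longrightarrow> x ^ (2 ^ m - 1) = 1" for x :: 'a
  unfolding CARD_eq[symmetric] by (rule power_CARD_minus_one)

lemma power_two_power_m: "x ^ 2 ^ m = x" for x :: 'a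
proof (cases "x = 0")
  case False
  have "x ^ 2 ^ m = x * x ^ (2 ^ m - 1)"
    by (simp flip: power_Suc)
  then show ?thesis
    by (simp only: power_two_power_m_minus_one[OF False] mult_1_right)
qed simp

lemma CHAR_eq_2: "CHAR('a) = 2"
proof (rule CHAR_eq_posI)
  have "- 1 = (1::'a)"
    using power_two_power_m[of "- 1"] m_pos by simp
  then show "of_nat 2 = (0::'a)"
    by (metis add.right_inverse of_nat_1 of_nat_add one_add_one)
next
  fix k :: nat
  assume "k > 0" and "k < 2"
  then have "k = 1"
    by simp
  then show "of_nat k \<noteq> (0::'a)"
    by simp
qed simp

lemma uminus_eq_self [simp]: "- x = (x::'a)"
  by (rule uminus_CHAR_2[OF CHAR_eq_2])

lemma add_self [simp]: "x + x = (0::'a)"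
  by (metis add.right_inverse uminus_eq_self)

lemma add_eq_0_iff_eq: "x + y = 0 \<longleftrightarrow> x = (y::'a)"
  by (metis eq_neg_iff_add_eq_0 uminus_eq_self)

lemma of_nat_eq_0_iff_even: "of_nat k = (0::'a) \<longleftrightarrow> even k"
  by (simp add: of_nat_eq_0_iff_char_dvd CHAR_eq_2)

lemma frobenius_add: "(x + y) ^ 2 ^ i = x ^ 2 ^ i + (y::'a) ^ 2 ^ i"
  by (rule freshmans_dream') (simp_all add: CHAR_eq_2)

lemma frobenius_sum: "sum f A ^ 2 ^ i = (\<Sum>a\<in>A. (f a :: 'a) ^ 2 ^ i)"
  by (rule freshmans_dream_sum') (simp_all add: CHAR_eq_2)

lemma bij_frobenius: "bij (\<lambda>x::'a. x ^ 2 ^ i)"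
proof -
  have "inj (\<lambda>x::'a. x ^ 2 ^ i)"
  proof (rule injI)
    fix x y :: 'a
    assume "x ^ 2 ^ i = y ^ 2 ^ i"
    then have "(x + y) ^ 2 ^ i = 0"
      by (simp add: frobenius_add)
    then show "x = y"
      by (simp add: add_eq_0_iff_eq)
  qed
  then show ?thesis
    by (simp add: bij_def finite_UNIV_inj_surj)
qed

lemma two_power_minus_one_pos: "k > 0 \<Longrightarrow> (2::nat) ^ k - 1 > 0"
  using one_less_power[of "2::nat" k] by simp

lemma card_two_power_minus_one_fibre:
  fixes y :: 'a
  assumes "y \<noteq> 0" and "k > 0"
  shows "card {x. x ^ (2 ^ k - 1) = y ^ (2 ^ k - 1)} = 2 ^ gcd k m - 1"
  using card_power_fibre[OF assms(1) two_power_minus_one_pos[OF assms(2)]]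
  by (simp only: CARD_eq gcd_power_minus_one_nat pos2)

definition trace :: "'a \<Rightarrow> 'a" where
  "trace x = (\<Sum>i<m. x ^ 2 ^ i)"

lemma trace_add: "trace (x + y) = trace x + trace y"
  by (simp add: trace_def frobenius_add sum.distrib)

lemma trace_square: "trace (x\<^sup>2) = trace x"
proof -
  have "x + trace (x\<^sup>2) = (\<Sum>i<Suc m. x ^ 2 ^ i)"
    by (subst sum.lessThan_Suc_shift) (simp add: trace_def flip: power_mult)
  also have "\<dots> = x + trace x"
    by (simp add: trace_def power_two_power_m add.commute)
  finally show ?thesis
    by simp
qed

lemma trace_frobenius: "trace (x ^ 2 ^ i) = trace x"
proof (induction i)
  case (Suc i)
  have "trace (x ^ 2 ^ Suc i) = trace ((x ^ 2 ^ i)\<^sup>2)"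
    by (simp add: mult.commute flip: power_mult)
  then show ?case
    by (simp add: trace_square Suc)
qed simp

lemma trace_eq_0_or_1: "trace x = 0 \<or> trace x = 1"
proof -
  have "(trace x)\<^sup>2 = trace (x\<^sup>2)"
    using frobenius_sum[of "\<lambda>i. x ^ 2 ^ i" "{..<m}" 1]
    by (simp add: trace_def mult.commute flip: power_mult)
  then have "trace x * trace x = trace x"
    by (simp only: trace_square power2_eq_square[of "trace x"])
  then show ?thesis
    by simp
qed

lemma exists_trace_nonzero: "\<exists>x. trace x \<noteq> 0"
proof (rule ccontr)
  assume "\<nexists>x. trace x \<noteq> 0"
  then have trace_0: "trace x = 0" for x
    by blast
  define p :: "'a poly" where "p = (\<Sum>i<m. monom 1 (2 ^ i))"
  have "coeff p 1 = (\<Sum>i<m. if i = 0 then 1 else 0)"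
    unfolding p_def coeff_sum by (intro sum.cong) auto
  then have "p \<noteq> 0"
    using m_pos by auto
  then have "card {x. poly p x = 0} \<le> degree p"
    by (rule card_poly_roots_bound)
  also have "{x. poly p x = 0} = UNIV"
    using trace_0 by (auto simp: p_def poly_sum poly_monom trace_def)
  also have "degree p \<le> 2 ^ (m - 1)"
    unfolding p_def by (intro degree_sum_le) (auto simp: degree_monom_eq)
  finally show False
    using m_pos by (simp add: CARD_eq)
qed

definition chi :: "'a \<Rightarrow> int" where
  "chi x = (if trace x = 0 then 1 else - 1)"

lemma chi_add: "chi (x + y) = chi x * chi y"
  using trace_eq_0_or_1[of x] trace_eq_0_or_1[of y] by (auto simp: chi_def trace_add)

lemma chi_0 [simp]: "chi 0 = 1"
  using chi_add[of 0 0] by (simp add: chi_def split: if_splits)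

lemma chi_mult_self: "chi x * chi x = 1"
  by (simp add: chi_def)

lemma chi_sum: "chi (sum f A) = (\<Prod>a\<in>A. chi (f a))"
  by (induction A rule: infinite_finite_induct) (simp_all add: chi_add)

lemma chi_frobenius: "chi (x ^ 2 ^ i) = chi x"
  by (simp add: chi_def trace_frobenius)

lemma sum_chi_mult: "(\<Sum>x\<in>UNIV. chi (c * x)) = (if c = 0 then 2 ^ m else 0)"
proof (cases "c = 0")
  case False
  obtain y where "trace y \<noteq> 0"
    using exists_trace_nonzero by blast
  with False have "chi (c * (y / c)) \<noteq> 1"
    by (simp add: chi_def)
  moreover have "(\<Sum>x\<in>UNIV. chi (c * x)) = 0 \<or> (\<forall>x\<in>UNIV. chi (c * x) = 1)"
    by (rule sum_character_subgroup) (simp_all add: distrib_left chi_add)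
  ultimately have "(\<Sum>x\<in>UNIV. chi (c * x)) = 0"
    by blast
  then show ?thesis
    by (simp add: False)
qed (simp add: CARD_eq)

end

section \<open>Krawtchouk polynomials and power moments\<close>

text \<open>
  This is \<open>k!\<close> times the \<open>k\<close>-th binary Krawtchouk polynomial of length \<open>n\<close>, in the variable
  \<open>s = n - 2 w\<close> instead of the weight \<open>w\<close>.
\<close>

fun krawtchouk :: "'a::comm_ring_1 \<Rightarrow> nat \<Rightarrow> 'a \<Rightarrow> 'a" where
  "krawtchouk n 0 s = 1"
| "krawtchouk n (Suc 0) s = s"
| "krawtchouk n (Suc (Suc k)) s =
     s * krawtchouk n (Suc k) s - (of_nat k + 1) * (n - of_nat k) * krawtchouk n k s"

lemma coeff_prod_one_plus_linear:
  fixes \<phi> :: "'a \<Rightarrow> 'b::comm_ring_1"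
  assumes "finite A"
  shows "coeff (\<Prod>x\<in>A. [:1, \<phi> x:]) k = (\<Sum>T | T \<subseteq> A \<and> card T = k. prod \<phi> T)"
proof -
  have "(\<Prod>x\<in>A. [:1, \<phi> x:]) = (\<Prod>x\<in>A. monom (\<phi> x) 1 + 1)"
    by (intro prod.cong) (simp_all add: monom_altdef one_pCons)
  also have "\<dots> = (\<Sum>T\<in>Pow A. \<Prod>x\<in>T. monom (\<phi> x) 1)"
    by (simp add: prod_add assms)
  also have "\<dots> = (\<Sum>T\<in>Pow A. monom (prod \<phi> T) (card T))"
  proof (rule sum.cong)
    fix T
    assume "T \<in> Pow A"
    show "(\<Prod>x\<in>T. monom (\<phi> x) 1) = monom (prod \<phi> T) (card T)"
      by (induction T rule: infinite_finite_induct) (simp_all add: mult_monom)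
  qed simp
  finally show ?thesis
    using assms
    by (simp add: coeff_sum sum.If_cases Int_def Pow_def)
qed

text \<open>
  The generating function \<open>F(z) = \<Prod>(1 + \<phi>\<^sub>x z)\<close> of the elementary symmetric functions of \<open>\<phi>\<close>
  satisfies a linear differential equation, because \<open>1 - z\<^sup>2 = (1 - \<phi>\<^sub>x z) (1 + \<phi>\<^sub>x z)\<close>
  for every \<open>x\<close>.
\<close>

lemma pderiv_prod_one_plus_linear:
  fixes \<phi> :: "'a \<Rightarrow> 'b::idom"
  assumes "finite A" and "\<forall>x\<in>A. \<phi> x * \<phi> x = 1"
  shows "[:1, 0, - 1:] * pderiv (\<Prod>x\<in>A. [:1, \<phi> x:]) =
    [:sum \<phi> A, - of_nat (card A):] * (\<Prod>x\<in>A. [:1, \<phi> x:])"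
proof -
  let ?F = "\<lambda>A. \<Prod>x\<in>A. [:1, \<phi> x:]"
  have "[:1, 0, - 1:] * (?F (A - {x}) * [:\<phi> x:]) = [:\<phi> x, - 1:] * ?F A" if "x \<in> A" for x
  proof -
    have "[:1, 0, - 1:] * (?F (A - {x}) * [:\<phi> x:]) = ([:1, 0, - 1:] * [:\<phi> x:]) * ?F (A - {x})"
      by (simp only: mult_ac)
    also have "[:1, 0, - 1:] * [:\<phi> x:] = [:\<phi> x, - 1:] * [:1, \<phi> x:]"
      using assms(2) that by simp
    also have "\<dots> * ?F (A - {x}) = [:\<phi> x, - 1:] * ?F A"
      by (simp only: prod.remove[OF assms(1) that] mult.assoc)
    finally show ?thesis .
  qed
  then have "[:1, 0, - 1:] * pderiv (?F A) = (\<Sum>x\<in>A. [:\<phi> x, - 1:]) * ?F A"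
    by (simp only: pderiv_prod pderiv_pCons sum_distrib_left sum_distrib_right)
      (simp add: pderiv_pCons)
  also have "(\<Sum>x\<in>A. [:\<phi> x, - 1:]) = [:sum \<phi> A, - of_nat (card A):]"
    by (induction A rule: infinite_finite_induct) simp_all
  finally show ?thesis .
qed

lemma coeff_prod_one_plus_linear_recursion:
  fixes \<phi> :: "'a \<Rightarrow> 'b::idom"
  assumes "finite A" and "\<forall>x\<in>A. \<phi> x * \<phi> x = 1"
  defines "F \<equiv> \<Prod>x\<in>A. [:1, \<phi> x:]"
  shows "coeff F 1 = sum \<phi> A * coeff F 0"
    and "(of_nat k + 2) * coeff F (Suc (Suc k)) =
      sum \<phi> A * coeff F (Suc k) - (of_nat (card A) - of_nat k) * coeff F k"
proof -
  have "[:1, 0, - 1:] * pderiv F = [:sum \<phi> A, - of_nat (card A):] * F"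
    unfolding F_def using assms(1,2) by (rule pderiv_prod_one_plus_linear)
  then have coeff_eq:
    "coeff ([:1, 0, - 1:] * pderiv F) i = coeff ([:sum \<phi> A, - of_nat (card A):] * F) i" for i
    by (simp only:)
  show "coeff F 1 = sum \<phi> A * coeff F 0"
    using coeff_eq[of 0] by (simp add: coeff_pderiv)
  show "(of_nat k + 2) * coeff F (Suc (Suc k)) =
      sum \<phi> A * coeff F (Suc k) - (of_nat (card A) - of_nat k) * coeff F k"
    using coeff_eq[of "Suc k"] by (cases k) (simp_all add: coeff_pderiv algebra_simps)
qed

lemma fact_sum_prod_eq_krawtchouk:
  fixes \<phi> :: "'a \<Rightarrow> 'b::{idom,ring_char_0}"
  assumes "finite A" and "\<forall>x\<in>A. \<phi> x * \<phi> x = 1"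
  shows "fact k * (\<Sum>T | T \<subseteq> A \<and> card T = k. prod \<phi> T) = krawtchouk (of_nat (card A)) k (sum \<phi> A)"
proof -
  define F where "F = (\<Prod>x\<in>A. [:1, \<phi> x:])"
  let ?n = "of_nat (card A) :: 'b" and ?s = "sum \<phi> A"
  have coeff_0: "coeff F 0 = 1"
    by (simp add: F_def flip: poly_0_coeff_0) (simp add: poly_prod)
  note recursion = coeff_prod_one_plus_linear_recursion[OF assms, folded F_def]
  have "fact k * coeff F k = krawtchouk ?n k ?s"
  proof (induction k rule: induct_nat_012)
    case (ge2 k)
    have "fact (Suc (Suc k)) * coeff F (Suc (Suc k)) =
        fact (Suc k) * ((of_nat k + 2) * coeff F (Suc (Suc k)))"
      by (simp add: algebra_simps)
    also have "\<dots> = ?s * (fact (Suc k) * coeff F (Suc k))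
        - (of_nat k + 1) * (?n - of_nat k) * (fact k * coeff F k)"
      unfolding recursion(2) by (simp add: algebra_simps)
    finally show ?case
      by (simp only: ge2 krawtchouk.simps)
  qed (use recursion(1) in \<open>simp_all add: coeff_0\<close>)
  then show ?thesis
    by (simp add: F_def coeff_prod_one_plus_linear[OF assms(1)])
qed

lemma krawtchouk_8:
  fixes n s :: "'a::idom"
  shows "krawtchouk n 8 s = s ^ 8 - (28 * n - 112) * s ^ 6 + (210 * n\<^sup>2 - 1540 * n + 2464) * s ^ 4
    - (420 * n ^ 3 - 4200 * n\<^sup>2 + 11872 * n - 8448) * s\<^sup>2 + 105 * n * (n - 2) * (n - 4) * (n - 6)"
  by (simp add: eval_nat_numeral) algebra

context binary_field
begin

definition walsh :: "('a \<Rightarrow> 'a) \<Rightarrow> 'a \<Rightarrow> 'a \<Rightarrow> int" where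
  "walsh f a b = (\<Sum>x\<in>UNIV. chi (a * f x + b * x))"

definition zero_sum_sets :: "('a \<Rightarrow> 'a) \<Rightarrow> nat \<Rightarrow> 'a set set" where
  "zero_sum_sets f k = {T. card T = k \<and> (\<Sum>x\<in>T. x) = 0 \<and> (\<Sum>x\<in>T. f x) = 0}"

lemma sum_prod_chi:
  "(\<Sum>a\<in>UNIV. \<Sum>b\<in>UNIV. \<Prod>x\<in>T. chi (a * f x + b * x)) =
     (if (\<Sum>x\<in>T. x) = 0 \<and> (\<Sum>x\<in>T. f x) = 0 then (2 ^ m)\<^sup>2 else 0)"
proof -
  have "(\<Sum>x\<in>T. a * f x + b * x) = (\<Sum>x\<in>T. f x) * a + (\<Sum>x\<in>T. x) * b" for a b
    by (simp add: sum.distrib sum_distrib_left mult.commute)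
  then have "(\<Prod>x\<in>T. chi (a * f x + b * x)) = chi ((\<Sum>x\<in>T. f x) * a) * chi ((\<Sum>x\<in>T. x) * b)" for a b
    unfolding chi_sum[symmetric] by (simp only: chi_add)
  then have "(\<Sum>a\<in>UNIV. \<Sum>b\<in>UNIV. \<Prod>x\<in>T. chi (a * f x + b * x)) =
      (\<Sum>a\<in>UNIV. chi ((\<Sum>x\<in>T. f x) * a)) * (\<Sum>b\<in>UNIV. chi ((\<Sum>x\<in>T. x) * b))"
    by (simp only: sum_product)
  then show ?thesis
    by (simp add: sum_chi_mult power2_eq_square)
qed

lemma fact_card_zero_sum_sets:
  "fact k * (2 ^ m)\<^sup>2 * int (card (zero_sum_sets f k)) =
     (\<Sum>a\<in>UNIV. \<Sum>b\<in>UNIV. krawtchouk (2 ^ m) k (walsh f a b))"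
proof -
  let ?\<phi> = "\<lambda>a b x. chi (a * f x + b * x)" and ?K = "{T :: 'a set. card T = k}"
  have "krawtchouk (2 ^ m) k (walsh f a b) = fact k * (\<Sum>T\<in>?K. prod (?\<phi> a b) T)" for a b
    using fact_sum_prod_eq_krawtchouk[of UNIV "?\<phi> a b" k]
    by (simp add: walsh_def chi_mult_self CARD_eq)
  then have "(\<Sum>a\<in>UNIV. \<Sum>b\<in>UNIV. krawtchouk (2 ^ m) k (walsh f a b)) =
      fact k * (\<Sum>a\<in>UNIV. \<Sum>b\<in>UNIV. \<Sum>T\<in>?K. prod (?\<phi> a b) T)"
    by (simp only: sum_distrib_left)
  also have "(\<Sum>a\<in>UNIV. \<Sum>b\<in>UNIV. \<Sum>T\<in>?K. prod (?\<phi> a b) T) =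
      (\<Sum>a\<in>UNIV. \<Sum>T\<in>?K. \<Sum>b\<in>UNIV. prod (?\<phi> a b) T)"
    by (intro sum.cong refl sum.swap)
  also have "\<dots> = (\<Sum>T\<in>?K. \<Sum>a\<in>UNIV. \<Sum>b\<in>UNIV. prod (?\<phi> a b) T)"
    by (rule sum.swap)
  also have "\<dots> = (2 ^ m)\<^sup>2 * int (card (zero_sum_sets f k))"
    unfolding sum_prod_chi by (simp add: sum.If_cases zero_sum_sets_def Int_def)
  finally show ?thesis
    by (simp only: mult.assoc)
qed

end

section \<open>The Walsh spectrum of the Gold function\<close>

locale gold = binary_field m field_type for m and field_type :: "'a::{field,finite} itself" +
  fixes e :: nat
  assumes e_pos: "e > 0"
begin

definition gold_fun :: "'a \<Rightarrow> 'a" where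
  "gold_fun x = x ^ (1 + 2 ^ e)"

definition gold_polar :: "'a \<Rightarrow> 'a \<Rightarrow> 'a" where
  "gold_polar u x = u * x ^ 2 ^ e + u ^ 2 ^ e * x"

text \<open>The radical of the bilinear form \<open>(u, x) \<mapsto> Tr (a (u x\<^bsup>Q\<^esup> + u\<^bsup>Q\<^esup> x))\<close>, where \<open>Q = 2\<^sup>e\<close>.\<close>

definition radical :: "'a \<Rightarrow> 'a set" where
  "radical a = {u. a ^ 2 ^ e * u ^ 2 ^ (2 * e) = a * u}"

lemma gold_fun_add: "gold_fun (u + x) = gold_fun u + gold_fun x + gold_polar u x"
  by (simp add: gold_fun_def gold_polar_def power_add frobenius_add algebra_simps)

lemma gold_fun_0: "gold_fun 0 = 0"
  by (simp add: gold_fun_def)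

lemma zero_in_radical: "0 \<in> radical a"
  by (simp add: radical_def)

lemma radical_add: "u \<in> radical a \<Longrightarrow> v \<in> radical a \<Longrightarrow> u + v \<in> radical a"
  by (simp add: radical_def frobenius_add distrib_left)

lemma chi_gold_polar:
  "chi (a * gold_polar u x) = chi ((a * u + a ^ 2 ^ e * u ^ 2 ^ (2 * e)) * x ^ 2 ^ e)"
proof -
  have "chi (a * gold_polar u x) = chi (a * u * x ^ 2 ^ e) * chi ((a * u ^ 2 ^ e * x) ^ 2 ^ e)"
    by (simp only: gold_polar_def chi_frobenius chi_add distrib_left mult.assoc)
  moreover have "(u ^ 2 ^ e) ^ 2 ^ e = u ^ 2 ^ (2 * e)"
    by (simp add: mult_2 power_add flip: power_mult)
  ultimately show ?thesis
    by (simp only: power_mult_distrib distrib_right chi_add)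
qed

lemma chi_gold_polar_radical: "u \<in> radical a \<Longrightarrow> chi (a * gold_polar u x) = 1"
  by (simp add: chi_gold_polar radical_def)

lemma sum_chi_gold_polar:
  "(\<Sum>x\<in>UNIV. chi (a * gold_polar u x)) = (if u \<in> radical a then 2 ^ m else 0)"
proof -
  let ?c = "a * u + a ^ 2 ^ e * u ^ 2 ^ (2 * e)"
  have "(\<Sum>x\<in>UNIV. chi (a * gold_polar u x)) = (\<Sum>x\<in>UNIV. chi (?c * x ^ 2 ^ e))"
    by (simp only: chi_gold_polar)
  also have "\<dots> = (\<Sum>z\<in>UNIV. chi (?c * z))"
    using bij_frobenius by (rule sum.reindex_bij_betw)
  also have "\<dots> = (if u \<in> radical a then 2 ^ m else 0)"
    unfolding sum_chi_mult by (auto simp: radical_def add_eq_0_iff_eq)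
  finally show ?thesis .
qed

lemma walsh_gold_square:
  "(walsh gold_fun a b)\<^sup>2 = 2 ^ m * (\<Sum>u\<in>radical a. chi (a * gold_fun u + b * u))"
proof -
  let ?\<psi> = "\<lambda>x. chi (a * gold_fun x + b * x)"
  have derivative: "?\<psi> x * ?\<psi> (u + x) = ?\<psi> u * chi (a * gold_polar u x)" for u x
  proof -
    have "?\<psi> (u + x) = ?\<psi> u * ?\<psi> x * chi (a * gold_polar u x)"
      unfolding gold_fun_add by (simp add: distrib_left chi_add)
    then show ?thesis
      using chi_mult_self[of "a * gold_fun x + b * x"] by algebra
  qed
  have "(walsh gold_fun a b)\<^sup>2 = (\<Sum>u\<in>UNIV. ?\<psi> u * (\<Sum>x\<in>UNIV. chi (a * gold_polar u x)))"
    unfolding walsh_def sum_square_shift derivative by (simp only: sum_distrib_left)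
  also have "\<dots> = (\<Sum>u\<in>UNIV. if u \<in> radical a then 2 ^ m * ?\<psi> u else 0)"
    unfolding sum_chi_gold_polar by (intro sum.cong) auto
  also have "\<dots> = (\<Sum>u\<in>radical a. 2 ^ m * ?\<psi> u)"
    by (simp add: sum.If_cases)
  finally show ?thesis
    by (simp only: sum_distrib_left)
qed

lemma walsh_gold_square_cases:
  "(walsh gold_fun a b)\<^sup>2 = 0 \<or> (walsh gold_fun a b)\<^sup>2 = 2 ^ m * int (card (radical a))"
proof -
  let ?\<psi> = "\<lambda>u. chi (a * gold_fun u + b * u)"
  have "sum ?\<psi> (radical a) = 0 \<or> (\<forall>u\<in>radical a. ?\<psi> u = 1)"
  proof (rule sum_character_subgroup)
    fix u v
    assume "u \<in> radical a"
    then show "?\<psi> (u + v) = ?\<psi> u * ?\<psi> v"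
      unfolding gold_fun_add by (simp add: distrib_left chi_add chi_gold_polar_radical)
  qed (simp_all add: radical_add)
  then show ?thesis
    by (auto simp: walsh_gold_square)
qed

lemma sum_walsh_gold_square: "(\<Sum>b\<in>UNIV. (walsh gold_fun a b)\<^sup>2) = (2 ^ m)\<^sup>2"
proof -
  have "chi (a * gold_fun u + b * u) = chi (a * gold_fun u) * chi (u * b)" for u b
    by (simp only: chi_add mult.commute)
  then have "(\<Sum>b\<in>UNIV. (walsh gold_fun a b)\<^sup>2)
      = 2 ^ m * (\<Sum>u\<in>radical a. chi (a * gold_fun u) * (\<Sum>b\<in>UNIV. chi (u * b)))"
    unfolding walsh_gold_square sum_distrib_left[symmetric]
    by (subst sum.swap) (simp only: sum_distrib_left)
  also have "\<dots> = 2 ^ m * (\<Sum>u\<in>radical a. if u = 0 then 2 ^ m else 0)"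
    unfolding sum_chi_mult
    by (intro arg_cong[where f = "\<lambda>s. 2 ^ m * s"] sum.cong) (auto simp: gold_fun_0)
  finally show ?thesis
    by (simp add: zero_in_radical power2_eq_square)
qed

definition radical_moment :: "nat \<Rightarrow> int" where
  "radical_moment j = (\<Sum>a\<in>UNIV. int (card (radical a)) ^ j)"

lemma sum_walsh_gold_power:
  "(\<Sum>a\<in>UNIV. \<Sum>b\<in>UNIV. walsh gold_fun a b ^ (2 * Suc j)) =
     (2 ^ m)\<^sup>2 * (2 ^ m) ^ j * radical_moment j"
proof -
  have "walsh gold_fun a b ^ (2 * Suc j) =
      (walsh gold_fun a b)\<^sup>2 * (2 ^ m * int (card (radical a))) ^ j" for a b
    using walsh_gold_square_cases[of a b] unfolding power_mult by auto
  then have "(\<Sum>a\<in>UNIV. \<Sum>b\<in>UNIV. walsh gold_fun a b ^ (2 * Suc j)) =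
      (\<Sum>a\<in>UNIV. (2 ^ m)\<^sup>2 * (2 ^ m * int (card (radical a))) ^ j)"
    by (simp only: sum_distrib_right[symmetric] sum_walsh_gold_square)
  then show ?thesis
    by (simp only: radical_moment_def power_mult_distrib sum_distrib_left mult.assoc)
qed

lemma mem_radical_iff:
  assumes "a \<noteq> 0" and "u \<noteq> 0"
  shows "u \<in> radical a \<longleftrightarrow> a ^ (2 ^ e - 1) * u ^ (2 ^ (2 * e) - 1) = 1"
proof -
  have split: "x ^ 2 ^ i = x * x ^ (2 ^ i - 1)" for x :: 'a and i
    by (simp flip: power_Suc)
  have "a ^ 2 ^ e * u ^ 2 ^ (2 * e) = (a * u) * (a ^ (2 ^ e - 1) * u ^ (2 ^ (2 * e) - 1))"
    by (simp only: split[of a e] split[of u "2 * e"]) (simp only: mult_ac)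
  then show ?thesis
    using assms by (simp add: radical_def)
qed

lemma card_radical_cases:
  assumes "a \<noteq> 0"
  shows "card (radical a) = 1 \<or> card (radical a) = 2 ^ gcd (2 * e) m"
proof (cases "radical a = {0}")
  case False
  let ?k = "2 ^ (2 * e) - 1 :: nat"
  have k: "?k > 0"
    using e_pos by (intro two_power_minus_one_pos) simp
  from False zero_in_radical[of a] obtain v where v: "v \<in> radical a" "v \<noteq> 0"
    by blast
  have "u \<in> radical a - {0} \<longleftrightarrow> u ^ ?k = v ^ ?k" for u
  proof (cases "u = 0")
    case False
    then have "u \<in> radical a \<longleftrightarrow> a ^ (2 ^ e - 1) * u ^ ?k = a ^ (2 ^ e - 1) * v ^ ?k"
      using v mem_radical_iff[OF assms] by metis
    with False assms show ?thesis
      by simp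
  qed (use k v in \<open>simp add: power_0_left\<close>)
  then have "radical a - {0} = {u. u ^ ?k = v ^ ?k}"
    by blast
  then have "card (radical a - {0}) = 2 ^ gcd (2 * e) m - 1"
    using card_two_power_minus_one_fibre[OF v(2), of "2 * e"] e_pos by simp
  then have "card (radical a) = Suc (2 ^ gcd (2 * e) m - 1)"
    using card.remove[OF _ zero_in_radical, of a] by simp
  then show ?thesis
    by simp
qed simp

lemma card_radical_containing:
  assumes "u \<noteq> 0"
  shows "card {a. a \<noteq> 0 \<and> u \<in> radical a} = 2 ^ gcd e m - 1"
proof -
  let ?k = "2 ^ e - 1 :: nat" and ?c = "inverse (u ^ (2 ^ e + 1))"
  have k: "?k > 0"
    using e_pos by (rule two_power_minus_one_pos)
  have "(2 ^ e + 1) * ?k = (2 ^ (2 * e) - 1 :: nat)"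
    by (simp only: mult_2 power_add) (simp add: algebra_simps)
  then have "u ^ (2 ^ (2 * e) - 1) = inverse (?c ^ ?k)"
    by (simp only: power_inverse inverse_inverse_eq power_mult[symmetric])
  then have "a \<noteq> 0 \<and> u \<in> radical a \<longleftrightarrow> a ^ ?k = ?c ^ ?k" for a
    using assms k by (cases "a = 0") (auto simp: mem_radical_iff power_0_left field_simps)
  moreover have "?c \<noteq> 0"
    using assms by simp
  ultimately show ?thesis
    by (simp only: card_two_power_minus_one_fibre[OF _ e_pos] not_False_eq_True)
qed

lemma sum_card_radical_minus_zero:
  "(\<Sum>a\<in>UNIV-{0}. card (radical a - {0})) = (2 ^ m - 1) * (2 ^ gcd e m - 1)"
proof -
  have "(\<Sum>a\<in>UNIV-{0}. card {u \<in> UNIV-{0}. u \<in> radical a}) =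
      (2 ^ gcd e m - 1) * card (UNIV - {0::'a})"
    by (rule sum_multicount) (simp_all add: card_radical_containing)
  moreover have "{u \<in> UNIV-{0}. u \<in> radical a} = radical a - {0}" for a
    by blast
  ultimately show ?thesis
    by (simp add: card_Diff_singleton CARD_eq)
qed

lemma sum_card_radical_power:
  "(2 ^ gcd (2 * e) m - 1) * (\<Sum>a\<in>UNIV-{0}. int (card (radical a)) ^ j) =
     (2 ^ m - 1) *
     (2 ^ gcd (2 * e) m - 2 ^ gcd e m + (2 ^ gcd e m - 1) * (2 ^ gcd (2 * e) m) ^ j)"
proof -
  let ?r = "2 ^ gcd (2 * e) m :: int" and ?s = "2 ^ gcd e m :: int"
  have interpolation: "(?r - 1) * int (card (radical a)) ^ j =
      (?r - 1) + (?r ^ j - 1) * int (card (radical a - {0}))" if "a \<noteq> 0" for a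
  proof -
    have minus_zero: "int (card (radical a - {0})) = int (card (radical a)) - 1"
      using card.remove[OF _ zero_in_radical, of a] by simp
    show ?thesis
      unfolding minus_zero using card_radical_cases[OF that] by (auto simp: algebra_simps)
  qed
  have "(?r - 1) * (\<Sum>a\<in>UNIV-{0}. int (card (radical a)) ^ j) =
      (\<Sum>a\<in>UNIV-{0}. (?r - 1) + (?r ^ j - 1) * int (card (radical a - {0})))"
    unfolding sum_distrib_left by (intro sum.cong refl interpolation) simp
  also have "\<dots> = int (card (UNIV - {0::'a})) * (?r - 1)
      + (?r ^ j - 1) * int (\<Sum>a\<in>UNIV-{0}. card (radical a - {0}))"
    by (simp add: sum.distrib sum_distrib_left)
  also have "\<dots> = (2 ^ m - 1) * (?r - 1) + (?r ^ j - 1) * ((2 ^ m - 1) * (?s - 1))"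
    unfolding sum_card_radical_minus_zero by (simp add: card_Diff_singleton CARD_eq of_nat_diff)
  finally show ?thesis
    by (simp add: algebra_simps)
qed

lemma card_radical_zero: "card (radical 0) = 2 ^ m"
  by (simp add: radical_def CARD_eq)

lemma radical_moment_gcd_2:
  assumes "4 dvd m" and "gcd m e = 2"
  shows "5 * radical_moment j = 5 * (2 ^ m) ^ j + (2 ^ m - 1) * (4 + 16 ^ j)"
proof -
  have "gcd (2 * e) m = 4"
  proof (rule dvd_antisym)
    have "gcd (2 * e) m dvd gcd (2 * e) (2 * m)"
      by simp
    also have "\<dots> = 4"
      using assms(2) by (simp add: gcd.commute flip: gcd_mult_distrib_nat)
    finally show "gcd (2 * e) m dvd 4" .
    have "even e"
      using assms(2) by (metis gcd_dvd2)
    then show "4 dvd gcd (2 * e) m"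
      using assms(1) by auto
  qed
  moreover have "gcd e m = 2"
    using assms(2) by (simp only: gcd.commute)
  ultimately have "15 * (\<Sum>a\<in>UNIV-{0}. int (card (radical a)) ^ j) =
      (2 ^ m - 1) * (12 + 3 * 16 ^ j)"
    using sum_card_radical_power[of j] by simp
  then show ?thesis
    by (simp add: radical_moment_def sum.remove[of UNIV 0] card_radical_zero algebra_simps)
qed

lemma card_zero_sum_sets_gold_8_radical_moments:
  fixes q :: int
  defines "q \<equiv> 2 ^ m"
  shows "40320 * int (card (zero_sum_sets gold_fun 8)) =
    q ^ 3 * radical_moment 3 - (28 * q - 112) * q\<^sup>2 * radical_moment 2
      + (210 * q\<^sup>2 - 1540 * q + 2464) * q * radical_moment 1
      - (420 * q ^ 3 - 4200 * q\<^sup>2 + 11872 * q - 8448) * radical_moment 0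
      + 105 * q * (q - 2) * (q - 4) * (q - 6)" (is "?A = ?M")
proof -
  let ?W = "\<lambda>k. \<Sum>a\<in>UNIV. \<Sum>b\<in>UNIV. walsh gold_fun a b ^ k"
  have moments: "?W 2 = q\<^sup>2 * radical_moment 0" "?W 4 = q\<^sup>2 * (q * radical_moment 1)"
    "?W 6 = q\<^sup>2 * (q\<^sup>2 * radical_moment 2)" "?W 8 = q\<^sup>2 * (q ^ 3 * radical_moment 3)"
    using sum_walsh_gold_power[of 0] sum_walsh_gold_power[of 1] sum_walsh_gold_power[of 2]
      sum_walsh_gold_power[of 3]
    by (simp_all add: q_def mult.assoc)
  have "q\<^sup>2 * ?A = (\<Sum>a\<in>UNIV. \<Sum>b\<in>UNIV. krawtchouk q 8 (walsh gold_fun a b))"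
    using fact_card_zero_sum_sets[of 8 gold_fun] by (simp add: q_def fact_numeral)
  also have "\<dots> = ?W 8 - (28 * q - 112) * ?W 6 + (210 * q\<^sup>2 - 1540 * q + 2464) * ?W 4
      - (420 * q ^ 3 - 4200 * q\<^sup>2 + 11872 * q - 8448) * ?W 2
      + q\<^sup>2 * (105 * q * (q - 2) * (q - 4) * (q - 6))"
    unfolding krawtchouk_8
    by (simp add: sum.distrib sum_subtractf CARD_eq q_def power2_eq_square flip: sum_distrib_left)
  also have "\<dots> = q\<^sup>2 * ?M"
    unfolding moments by (simp add: algebra_simps)
  finally show ?thesis
    by (simp add: q_def)
qed

lemma card_zero_sum_sets_gold_8:
  fixes q :: int
  assumes "4 dvd m" and "gcd m e = 2"
  defines "q \<equiv> 2 ^ m"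
  shows "40320 * int (card (zero_sum_sets gold_fun 8)) =
    q * (q - 1) * (q ^ 4 - 27 * q ^ 3 + 184 * q\<^sup>2 + 1044 * q + 6448)"
proof -
  have "5 * radical_moment j = 5 * q ^ j + (q - 1) * (4 + 16 ^ j)" for j
    using radical_moment_gcd_2[OF assms(1,2)] by (simp only: q_def)
  from this[of 0] this[of 1] this[of 2] this[of 3]
  have moments: "radical_moment 0 = q" "radical_moment 1 = q + 4 * (q - 1)"
    "radical_moment 2 = q\<^sup>2 + 52 * (q - 1)" "radical_moment 3 = q ^ 3 + 820 * (q - 1)"
    by simp_all
  show ?thesis
    unfolding card_zero_sum_sets_gold_8_radical_moments[folded q_def] moments by algebra
qed

end

section \<open>Designs from doubly transitive actions\<close>

lemma two_design_double_counting:
  assumes "two_design V B v k l"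
  shows "card B * (k * (k - 1)) = l * (v * (v - 1))"
proof -
  let ?pairs = "{P. P \<subseteq> V \<and> card P = 2}"
  have V: "finite V" "card V = v" and blocks: "\<And>b. b \<in> B \<Longrightarrow> b \<subseteq> V \<and> card b = k"
    and through: "\<And>P. P \<in> ?pairs \<Longrightarrow> card {b \<in> B. P \<subseteq> b} = l"
    using assms by (auto simp: two_design_def)
  have "finite B"
    by (rule finite_subset[of _ "Pow V"]) (use blocks V(1) in auto)
  have "card {P \<in> ?pairs. P \<subseteq> b} = k choose 2" if "b \<in> B" for b
  proof -
    have "{P \<in> ?pairs. P \<subseteq> b} = {P. P \<subseteq> b \<and> card P = 2}"
      using blocks[OF that] by auto
    then show ?thesis
      using blocks[OF that] V(1) by (metis finite_subset n_subsets)
  qed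
  then have "(\<Sum>P\<in>?pairs. card {b \<in> B. P \<subseteq> b}) = (k choose 2) * card B"
    using V(1) \<open>finite B\<close> by (intro sum_multicount) simp_all
  moreover have "(\<Sum>P\<in>?pairs. card {b \<in> B. P \<subseteq> b}) = (v choose 2) * l"
    using through V by (simp add: n_subsets)
  moreover have "n * (n - 1) = 2 * (n choose 2)" for n :: nat
    by (cases n) (simp_all add: choose_two)
  ultimately show ?thesis
    by (simp add: mult.commute)
qed

lemma two_design_if_two_transitive:
  assumes "finite V" and blocks: "\<And>b. b \<in> B \<Longrightarrow> b \<subseteq> V \<and> card b = k"
    and transitive: "\<And>x y x' y'. {x, y, x', y'} \<subseteq> V \<Longrightarrow> x \<noteq> y \<Longrightarrow> x' \<noteq> y' \<Longrightarrow>
      \<exists>\<pi>. inj_on \<pi> V \<and> \<pi> x = x' \<and> \<pi> y = y' \<and> (\<forall>b\<in>B. \<pi> ` b \<in> B)"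
  shows "\<exists>l. two_design V B (card V) k l"
proof -
  define through where "through P = {b \<in> B. P \<subseteq> b}" for P
  have "finite B"
    by (rule finite_subset[of _ "Pow V"]) (use blocks \<open>finite V\<close> in auto)
  have "card (through P) \<le> card (through P')"
    if P: "P \<subseteq> V" "card P = 2" and P': "P' \<subseteq> V" "card P' = 2" for P P'
  proof -
    obtain x y x' y' where "P = {x, y}" "x \<noteq> y" "P' = {x', y'}" "x' \<noteq> y'"
      using P(2) P'(2) unfolding card_2_iff by metis
    with P(1) P'(1) obtain \<pi> where \<pi>: "inj_on \<pi> V" "\<pi> ` P = P'" "\<And>b. b \<in> B \<Longrightarrow> \<pi> ` b \<in> B"
      using transitive[of x y x' y'] by auto
    show ?thesis
    proof (rule card_inj_on_le)
      show "inj_on (image \<pi>) (through P)"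
        using blocks unfolding through_def
        by (intro inj_on_subset[OF inj_on_image_Pow[OF \<pi>(1)]]) auto
      show "image \<pi> ` through P \<subseteq> through P'"
        using \<pi>(2,3) unfolding through_def by blast
    qed (simp add: through_def \<open>finite B\<close>)
  qed
  then have "\<exists>l. \<forall>P. P \<subseteq> V \<and> card P = 2 \<longrightarrow> card (through P) = l"
    by (metis le_antisym)
  then show ?thesis
    using assms(1) blocks unfolding two_design_def through_def by blast
qed

lemma two_design_if_affine_invariant:
  fixes B :: "'a::{field,finite} set set"
  assumes "\<And>b. b \<in> B \<Longrightarrow> card b = k"
    and "\<And>b u v. b \<in> B \<Longrightarrow> u \<noteq> 0 \<Longrightarrow> (\<lambda>z. u * z + v) ` b \<in> B"
  shows "\<exists>l. two_design UNIV B CARD('a) k l"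
proof (rule two_design_if_two_transitive)
  fix x y x' y' :: 'a
  assume "x \<noteq> y" "x' \<noteq> y'"
  define u where "u = (x' - y') / (x - y)"
  have "u \<noteq> 0"
    using \<open>x \<noteq> y\<close> \<open>x' \<noteq> y'\<close> by (simp add: u_def)
  moreover have "u * y + (x' - u * x) = y'"
  proof -
    have "u * (x - y) = x' - y'"
      using \<open>x \<noteq> y\<close> by (simp add: u_def)
    then show ?thesis
      by (simp add: algebra_simps)
  qed
  ultimately show "\<exists>\<pi>. inj_on \<pi> UNIV \<and> \<pi> x = x' \<and> \<pi> y = y' \<and> (\<forall>b\<in>B. \<pi> ` b \<in> B)"
    using assms(2) by (intro exI[of _ "\<lambda>z. u * z + (x' - u * x)"]) (auto simp: inj_on_def)
qed (use assms(1) in auto)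

lemma bij_betw_image_blocks_through:
  assumes h: "bij_betw h V W" and "\<And>b. b \<in> B \<Longrightarrow> b \<subseteq> W" and "P \<subseteq> V"
  shows "bij_betw (image h) {S. S \<subseteq> V \<and> h ` S \<in> B \<and> P \<subseteq> S} {b \<in> B. h ` P \<subseteq> b}"
proof (rule bij_betw_subset[OF bij_betw_Pow[OF h]])
  show "image h ` {S. S \<subseteq> V \<and> h ` S \<in> B \<and> P \<subseteq> S} = {b \<in> B. h ` P \<subseteq> b}"
  proof (intro equalityI subsetI)
    fix b
    assume b: "b \<in> {b \<in> B. h ` P \<subseteq> b}"
    then have "h ` {s \<in> V. h s \<in> b} = b"
      using assms(2)[of b] bij_betw_imp_surj_on[OF h] by auto
    with b assms(3) show "b \<in> image h ` {S. S \<subseteq> V \<and> h ` S \<in> B \<and> P \<subseteq> S}"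
      by (intro image_eqI[of _ _ "{s \<in> V. h s \<in> b}"]) auto
  qed auto
qed auto

lemma two_design_vimage:
  assumes h: "bij_betw h V W" and "two_design W B v k l"
  shows "two_design V {S. S \<subseteq> V \<and> h ` S \<in> B} v k l"
proof -
  have W: "finite W" "card W = v" and blocks: "\<And>b. b \<in> B \<Longrightarrow> b \<subseteq> W \<and> card b = k"
    and pairs: "\<And>P. P \<subseteq> W \<Longrightarrow> card P = 2 \<Longrightarrow> card {b \<in> B. P \<subseteq> b} = l"
    using assms(2) by (auto simp: two_design_def)
  have card_image_h: "card (h ` S) = card S" if "S \<subseteq> V" for S
    using bij_betw_imp_inj_on[OF h] that by (intro card_image) (rule inj_on_subset)
  have "card {S \<in> {S. S \<subseteq> V \<and> h ` S \<in> B}. P \<subseteq> S} = l" if P: "P \<subseteq> V" "card P = 2" for P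
  proof -
    have "card {S. S \<subseteq> V \<and> h ` S \<in> B \<and> P \<subseteq> S} = card {b \<in> B. h ` P \<subseteq> b}"
      using bij_betw_image_blocks_through[OF h _ P(1)] blocks by (intro bij_betw_same_card) blast
    also have "\<dots> = l"
      using P card_image_h bij_betw_imp_surj_on[OF h] by (intro pairs) auto
    finally show ?thesis
      by (simp add: conj_assoc)
  qed
  moreover have "finite V" "card V = v"
    using W bij_betw_finite[OF h] bij_betw_same_card[OF h] by simp_all
  moreover have "card S = k" if "S \<subseteq> V" "h ` S \<in> B" for S
    using that blocks card_image_h by metis
  ultimately show ?thesis
    by (simp add: two_design_def)
qed

context gold
begin

lemma affine_image_zero_sum_sets:
  assumes "T \<in> zero_sum_sets gold_fun k" and "even k" and "u \<noteq> 0"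
  shows "(\<lambda>z. u * z + v) ` T \<in> zero_sum_sets gold_fun k"
proof -
  have inj: "inj_on (\<lambda>z. u * z + v) T"
    using assms(3) by (simp add: inj_on_def)
  have T: "card T = k" "(\<Sum>z\<in>T. z) = 0" "(\<Sum>z\<in>T. gold_fun z) = 0"
    using assms(1) by (simp_all add: zero_sum_sets_def)
  have const: "(\<Sum>z\<in>T. c) = 0" for c :: 'a
    using T(1) assms(2) of_nat_eq_0_iff_even by simp
  have frobenius: "(\<Sum>z\<in>T. z ^ 2 ^ e) = 0"
    using frobenius_sum[of "\<lambda>z. z" T e] T(2) by (simp add: power_0_left)
  have linear: "(\<Sum>z\<in>T. u * z + v) = 0"
    by (simp only: sum.distrib sum_distrib_left[symmetric] T const mult_zero_right add_0_left)
  have "gold_fun (u * z + v) = gold_fun u * gold_fun z + gold_fun v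
      + (u * v ^ 2 ^ e * z + u ^ 2 ^ e * v * z ^ 2 ^ e)" for z
    unfolding gold_fun_add by (simp add: gold_fun_def gold_polar_def power_mult_distrib mult_ac)
  then have "(\<Sum>z\<in>T. gold_fun (u * z + v)) = 0"
    by (simp only: sum.distrib sum_distrib_left[symmetric] T const frobenius mult_zero_right
        add_0_left)
  with linear T(1) show ?thesis
    by (simp add: zero_sum_sets_def sum.reindex[OF inj] card_image[OF inj])
qed

lemma exists_two_design_zero_sum_sets:
  assumes "even k"
  shows "\<exists>l. two_design UNIV (zero_sum_sets gold_fun k) (2 ^ m) k l"
  unfolding CARD_eq[symmetric]
  by (rule two_design_if_affine_invariant)
    (use affine_image_zero_sum_sets[OF _ assms] in \<open>auto simp: zero_sum_sets_def\<close>)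

lemma two_design_gold_8_index:
  fixes q :: int
  assumes design: "two_design UNIV (zero_sum_sets gold_fun 8) (2 ^ m) 8 l"
    and "4 dvd m" and "gcd m e = 2"
  defines "q \<equiv> 2 ^ m"
  shows "720 * int l = q ^ 4 - 27 * q ^ 3 + 184 * q\<^sup>2 + 1044 * q + 6448" (is "_ = ?p")
proof -
  have "q > 1"
    using m_pos by (simp add: q_def one_less_power)
  have "int (card (zero_sum_sets gold_fun 8) * (8 * (8 - 1))) = int (l * (2 ^ m * (2 ^ m - 1)))"
    using two_design_double_counting[OF design] by (rule arg_cong)
  then have "56 * int (card (zero_sum_sets gold_fun 8)) = int l * (q * (q - 1))"
    by (simp add: q_def of_nat_diff mult.commute)
  moreover have "40320 * int (card (zero_sum_sets gold_fun 8)) = q * (q - 1) * ?p"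
    unfolding q_def using assms(2,3) by (rule card_zero_sum_sets_gold_8)
  ultimately have "q * (q - 1) * (720 * int l) = q * (q - 1) * ?p"
    by (simp add: algebra_simps)
  moreover have "q * (q - 1) \<noteq> 0"
    using \<open>q > 1\<close> by simp
  ultimately show ?thesis
    using mult_left_cancel by blast
qed

lemma two_design_gold_8_index_real:
  assumes "two_design UNIV (zero_sum_sets gold_fun 8) (2 ^ m) 8 l" and "4 dvd m" and "gcd m e = 2"
  shows "real l = (2 ^ (4 * m - 4) - 27 * 2 ^ (3 * m - 4) + 23 * 2 ^ (2 * m - 1)
    + 261 * 2 ^ (m - 2) + 403) / 45"
proof -
  define q :: real where "q = 2 ^ m"
  have "real_of_int (720 * int l) = real_of_int
      ((2 ^ m) ^ 4 - 27 * (2 ^ m) ^ 3 + 184 * (2 ^ m)\<^sup>2 + 1044 * 2 ^ m + 6448)"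
    using two_design_gold_8_index[OF assms] by (rule arg_cong)
  then have "720 * real l = q ^ 4 - 27 * q ^ 3 + 184 * q\<^sup>2 + 1044 * q + 6448"
    by (simp add: q_def)
  moreover have "m \<ge> 4"
    using assms(2) m_pos by (rule dvd_imp_le)
  then have "(2::real) ^ (4 * m - 4) = q ^ 4 / 16" "(2::real) ^ (3 * m - 4) = q ^ 3 / 16"
    "(2::real) ^ (2 * m - 1) = q\<^sup>2 / 2" "(2::real) ^ (m - 2) = q / 4"
    by (simp_all add: q_def power_diff power_mult[symmetric] mult.commute)
  ultimately show ?thesis
    by simp
qed

end

section \<open>Supports of codewords\<close>

lemma sum_list_bit_eq_0_iff: "sum_list c = 0 \<longleftrightarrow> even (card (support c))" for c :: "bit list"
proof -
  have "sum_list c = (\<Sum>i<length c. c ! i)"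
    by (simp add: sum_list_sum_nth atLeast0LessThan)
  also have "\<dots> = (\<Sum>i\<in>support c. 1)"
    by (rule sum.mono_neutral_cong_right) (auto simp: support_def)
  finally have "sum_list c = of_nat (card (support c))"
    by simp
  moreover have "b = 0 \<longleftrightarrow> even b" for b :: bit
    by (cases b) simp_all
  ultimately show ?thesis
    by (simp only: even_of_nat_iff)
qed

lemma support_subset: "support c \<subseteq> {..<length c}"
  by (auto simp: support_def)

lemma support_append_parity_bit:
  "support (c @ [sum_list c]) =
     (if even (card (support c)) then support c else insert (length c) (support c))"
proof -
  have "support (c @ [b]) = (if b = 0 then support c else insert (length c) (support c))" for b
    by (auto simp: support_def nth_append less_Suc_eq)
  then show ?thesis
    by (simp add: sum_list_bit_eq_0_iff)
qed

lemma support_image_extended_code: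
  assumes "\<And>c. c \<in> C \<Longrightarrow> length c = n"
  shows "support ` extended_code C = {S. S \<subseteq> {..n} \<and> even (card S) \<and> S \<inter> {..<n} \<in> support ` C}"
proof (intro equalityI subsetI)
  fix S
  assume "S \<in> support ` extended_code C"
  then obtain c where c: "c \<in> C" and "S = support (c @ [sum_list c])"
    by (auto simp: extended_code_def)
  then have S: "S = (if even (card (support c)) then support c else insert n (support c))"
    using assms by (simp only: support_append_parity_bit)
  have sub: "support c \<subseteq> {..<n}"
    using support_subset[of c] assms[OF c] by simp
  then have "finite (support c)" "n \<notin> support c"
    by (auto intro: finite_subset)
  then have "even (card S)"
    by (simp add: S)
  moreover have "S \<inter> {..<n} = support c" "S \<subseteq> {..n}"
    using sub by (auto simp: S)
  ultimately show "S \<in> {S. S \<subseteq> {..n} \<and> even (card S) \<and> S \<inter> {..<n} \<in> support ` C}"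
    using c by blast
next
  fix S
  assume "S \<in> {S. S \<subseteq> {..n} \<and> even (card S) \<and> S \<inter> {..<n} \<in> support ` C}"
  then obtain c where S: "S \<subseteq> {..n}" "even (card S)" and c: "c \<in> C" "S \<inter> {..<n} = support c"
    by blast
  have "S = (if n \<in> S then insert n (S \<inter> {..<n}) else S \<inter> {..<n})"
    using S(1) by (auto simp: le_less)
  then have S_cases: "S = (if n \<in> S then insert n (support c) else support c)"
    by (simp only: c(2))
  have "finite (support c)" "n \<notin> support c"
    by (auto simp flip: c(2))
  then have "even (card (support c)) \<longleftrightarrow> n \<notin> S"
    using S(2) S_cases by (metis card_insert_disjoint even_Suc)
  then have "S = support (c @ [sum_list c])"
    using S_cases by (cases "n \<in> S") (simp_all add: support_append_parity_bit assms[OF c(1)])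
  with c(1) show "S \<in> support ` extended_code C"
    by (auto simp: extended_code_def)
qed

lemma exists_support_eq:
  assumes "S \<subseteq> {..<n}"
  shows "\<exists>c. length c = n \<and> support c = S"
  using assms by (intro exI[of _ "map (\<lambda>i. of_bool (i \<in> S)) [0..<n]"]) (auto simp: support_def)

lemma degree_diff_less_if_lead_coeff_eq:
  fixes p q :: "'a::ab_group_add poly"
  assumes "degree p = degree q" and "lead_coeff p = lead_coeff q" and "p \<noteq> q"
  shows "degree (p - q) < degree p"
proof (rule degree_lessI)
  show "p - q \<noteq> 0 \<or> degree p > 0"
    using assms(3) by simp
  show "\<forall>k\<ge>degree p. coeff (p - q) k = 0"
    using assms(1,2) by (metis coeff_diff coeff_eq_0 le_neq_implies_less diff_self)
qed

lemma mem_cyclic_code_iff: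
  assumes "g dvd monom 1 n - 1"
  shows "c \<in> cyclic_code n g \<longleftrightarrow> length c = n \<and> g dvd Poly c"
proof -
  have "(\<exists>a. [Poly c = a * g] (mod (monom 1 n - 1))) \<longleftrightarrow> g dvd Poly c"
  proof
    assume "\<exists>a. [Poly c = a * g] (mod (monom 1 n - 1))"
    then obtain a where "[Poly c = a * g] (mod (monom 1 n - 1))"
      by blast
    then have "[Poly c = a * g] (mod g)"
      using assms by (rule cong_dvd_modulus)
    then show "g dvd Poly c"
      using cong_dvd_iff[of "Poly c" "a * g" g] by simp
  qed (metis cong_refl dvd_def mult.commute)
  then show ?thesis
    by (simp add: cyclic_code_def)
qed

context binary_field
begin

lemma of_bit_add: "(of_bit (a + b) :: 'a) = of_bit a + of_bit b"
  by (cases a; cases b) simp_all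

lemma of_bit_mult: "(of_bit (a * b) :: 'a) = of_bit a * of_bit b"
  by (cases a; cases b) simp_all

lemma of_bit_sum: "(of_bit (sum f A) :: 'a) = (\<Sum>i\<in>A. of_bit (f i))"
proof (induction A rule: infinite_finite_induct)
  case (insert i A)
  show ?case
    by (simp only: sum.insert[OF insert.hyps] of_bit_add insert.IH)
qed simp_all

definition eval_bit :: "bit poly \<Rightarrow> 'a \<Rightarrow> 'a" where
  "eval_bit p x = poly (map_poly of_bit p) x"

lemma eval_bit_0 [simp]: "eval_bit 0 x = 0"
  by (simp add: eval_bit_def)

lemma eval_bit_1 [simp]: "eval_bit 1 x = 1"
  by (simp add: eval_bit_def)

lemma eval_bit_monom: "eval_bit (monom 1 k) x = x ^ k"
  by (simp add: eval_bit_def map_poly_monom poly_monom)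

lemma eval_bit_add: "eval_bit (p + q) x = eval_bit p x + eval_bit q x"
proof -
  have "map_poly of_bit (p + q) = map_poly of_bit p + (map_poly of_bit q :: 'a poly)"
    by (rule poly_eqI) (simp add: coeff_map_poly of_bit_add del: add_bit_eq_xor)
  then show ?thesis
    by (simp add: eval_bit_def)
qed

lemma eval_bit_diff: "eval_bit (p - q) x = eval_bit p x + eval_bit q x"
  using eval_bit_add[of "p - q" q x] by (simp add: add.assoc)

lemma eval_bit_mult: "eval_bit (p * q) x = eval_bit p x * eval_bit q x"
proof -
  have coeff_map: "coeff (map_poly of_bit r) n = (of_bit (coeff r n) :: 'a)" for r n
    by (simp add: coeff_map_poly)
  have "map_poly of_bit (p * q) = map_poly of_bit p * (map_poly of_bit q :: 'a poly)"
    by (rule poly_eqI) (simp only: coeff_map coeff_mult of_bit_sum of_bit_mult)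
  then show ?thesis
    by (simp add: eval_bit_def)
qed

lemma eval_bit_Poly: "eval_bit (Poly c) x = (\<Sum>i\<in>support c. x ^ i)"
proof -
  have "eval_bit (Poly c) x = (\<Sum>i<length c. of_bit (c ! i) * x ^ i)"
  proof (induction c)
    case (Cons b c)
    have "eval_bit (Poly (b # c)) x = of_bit b + x * eval_bit (Poly c) x"
      by (simp add: eval_bit_def map_poly_pCons)
    then show ?case
      by (simp only: Cons.IH length_Cons sum.lessThan_Suc_shift nth_Cons_0 nth_Cons_Suc power_0
          power_Suc mult_1_right sum_distrib_left mult.left_commute)
  qed simp
  also have "\<dots> = (\<Sum>i\<in>support c. x ^ i)"
    by (rule sum.mono_neutral_cong_right) (auto simp: support_def)
  finally show ?thesis .
qed

lemma exists_annihilating_poly: "\<exists>p. p \<noteq> 0 \<and> eval_bit p x = 0"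
proof (intro exI conjI)
  have "coeff (monom 1 1 - monom 1 (2 ^ m) :: bit poly) 1 = 1"
    using m_pos by simp
  then show "monom 1 1 - monom 1 (2 ^ m) \<noteq> (0 :: bit poly)"
    by (metis coeff_0 zero_neq_one)
  show "eval_bit (monom 1 1 - monom 1 (2 ^ m)) x = 0"
    by (simp only: eval_bit_diff eval_bit_monom power_two_power_m power_one_right add_self)
qed

lemma
  shows lead_coeff_min_poly2: "lead_coeff (min_poly2 x) = 1"
    and eval_bit_min_poly2: "eval_bit (min_poly2 x) x = 0"
    and degree_min_poly2_le: "\<And>q. q \<noteq> 0 \<Longrightarrow> eval_bit q x = 0 \<Longrightarrow> degree (min_poly2 x) \<le> degree q"
proof -
  let ?annihilates = "\<lambda>q. q \<noteq> 0 \<and> eval_bit q x = 0"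
  let ?minimal = "\<lambda>p. lead_coeff p = 1 \<and> eval_bit p x = 0 \<and>
    (\<forall>q. ?annihilates q \<longrightarrow> degree p \<le> degree q)"
  obtain p where p: "?annihilates p" and degree_le: "\<And>q. ?annihilates q \<Longrightarrow> degree p \<le> degree q"
    using exists_annihilating_poly ex_has_least_nat[of ?annihilates _ degree] by blast
  have "lead_coeff p = 1"
    using p by (metis bit_not_zero_iff leading_coeff_0_iff)
  with p degree_le have minimal_p: "?minimal p"
    by blast
  moreover have "r = p" if minimal_r: "?minimal r" for r
  proof (rule ccontr)
    assume "r \<noteq> p"
    have "r \<noteq> 0"
      using minimal_r by auto
    then have "degree r = degree p"
      using minimal_r minimal_p p by (intro antisym) blast+
    then have "degree (r - p) < degree p"
      using minimal_r minimal_p \<open>r \<noteq> p\<close> by (metis degree_diff_less_if_lead_coeff_eq)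
    moreover have "?annihilates (r - p)"
      using \<open>r \<noteq> p\<close> minimal_r minimal_p by (simp add: eval_bit_diff)
    ultimately show False
      using degree_le by (simp add: leD)
  qed
  ultimately have "?minimal (THE p. ?minimal p)"
    by (rule theI)
  then have "?minimal (min_poly2 x)"
    unfolding min_poly2_def eval_bit_def .
  then show "lead_coeff (min_poly2 x) = 1" "eval_bit (min_poly2 x) x = 0"
    "\<And>q. q \<noteq> 0 \<Longrightarrow> eval_bit q x = 0 \<Longrightarrow> degree (min_poly2 x) \<le> degree q"
    by blast+
qed

lemma min_poly2_dvd_iff: "min_poly2 x dvd p \<longleftrightarrow> eval_bit p x = 0"
proof
  assume "min_poly2 x dvd p"
  then show "eval_bit p x = 0"
    by (auto simp: eval_bit_mult eval_bit_min_poly2 elim!: dvdE)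
next
  assume "eval_bit p x = 0"
  moreover have "eval_bit p x = eval_bit (p div min_poly2 x * min_poly2 x + p mod min_poly2 x) x"
    by simp
  ultimately have remainder: "eval_bit (p mod min_poly2 x) x = 0"
    by (simp only: eval_bit_add eval_bit_mult eval_bit_min_poly2 mult_zero_right add_0_left)
  have "min_poly2 x \<noteq> 0"
    using lead_coeff_min_poly2[of x] by auto
  then have "p mod min_poly2 x = 0"
    using degree_mod_less[of "min_poly2 x" p] degree_min_poly2_le[OF _ remainder] by force
  then show "min_poly2 x dvd p"
    by (simp add: mod_eq_0_iff_dvd)
qed

lemma support_image_cyclic_code_lcm_min_poly2:
  fixes x y :: 'a
  assumes "x ^ n = 1" and "y ^ n = 1"
  shows "support ` cyclic_code n (lcm (min_poly2 x) (min_poly2 y)) =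
    {S. S \<subseteq> {..<n} \<and> (\<Sum>i\<in>S. x ^ i) = 0 \<and> (\<Sum>i\<in>S. y ^ i) = 0}"
proof -
  let ?g = "lcm (min_poly2 x) (min_poly2 y)"
  have "?g dvd monom 1 n - 1"
    using assms by (simp add: min_poly2_dvd_iff eval_bit_diff eval_bit_monom)
  from mem_cyclic_code_iff[OF this]
  have mem: "c \<in> cyclic_code n ?g \<longleftrightarrow> length c = n \<and>
      (\<Sum>i\<in>support c. x ^ i) = 0 \<and> (\<Sum>i\<in>support c. y ^ i) = 0" for c
    by (simp only: lcm_least_iff min_poly2_dvd_iff eval_bit_Poly)
  show ?thesis
  proof (intro equalityI subsetI)
    fix S
    assume S: "S \<in> {S. S \<subseteq> {..<n} \<and> (\<Sum>i\<in>S. x ^ i) = 0 \<and> (\<Sum>i\<in>S. y ^ i) = 0}"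
    then obtain c where c: "length c = n" "support c = S"
      using exists_support_eq by blast
    with S have "c \<in> cyclic_code n ?g"
      by (simp add: mem)
    with c(2) show "S \<in> support ` cyclic_code n ?g"
      by blast
  qed (auto simp: mem dest: subsetD[OF support_subset])
qed

end

lemma generator_nonzero:
  fixes \<alpha> :: "'a::{zero,monoid_mult}"
  assumes "range (\<lambda>i::nat. \<alpha> ^ i) = UNIV - {0}"
  shows "\<alpha> \<noteq> 0"
  using assms by (metis DiffD2 power_one_right rangeI singletonI)

definition coordinate :: "'a::{field,finite} \<Rightarrow> nat \<Rightarrow> 'a" where
  "coordinate \<alpha> i = (if i < CARD('a) - 1 then \<alpha> ^ i else 0)"

lemma bij_betw_generator_power:
  fixes \<alpha> :: "'a::{field,finite}"
  assumes "range (\<lambda>i::nat. \<alpha> ^ i) = UNIV - {0}"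
  shows "bij_betw (\<lambda>i. \<alpha> ^ i) {..<CARD('a) - 1} (UNIV - {0})"
proof -
  let ?n = "CARD('a) - 1"
  have "\<alpha> ^ ?n = 1"
    using generator_nonzero[OF assms] by (rule power_CARD_minus_one)
  then have "\<alpha> ^ (?n * (i div ?n) + i mod ?n) = \<alpha> ^ (i mod ?n)" for i
    by (simp only: power_add power_mult power_one mult_1)
  then have "\<alpha> ^ i = \<alpha> ^ (i mod ?n)" for i
    by (simp only: mult_div_mod_eq)
  moreover have "?n > 0"
    using one_less_CARD_field[where ?'a = 'a] by simp
  ultimately have "\<alpha> ^ i \<in> (\<lambda>i. \<alpha> ^ i) ` {..<?n}" for i
    by (intro image_eqI[of _ _ "i mod ?n"]) simp_all
  then have "(\<lambda>i. \<alpha> ^ i) ` {..<?n} = UNIV - {0}"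
    unfolding assms[symmetric] by blast
  moreover from this have "inj_on (\<lambda>i. \<alpha> ^ i) {..<?n}"
    by (intro eq_card_imp_inj_on) (simp_all add: card_Diff_singleton)
  ultimately show ?thesis
    by (simp only: bij_betw_def)
qed

lemma bij_betw_coordinate:
  fixes \<alpha> :: "'a::{field,finite}"
  assumes "range (\<lambda>i::nat. \<alpha> ^ i) = UNIV - {0}"
  shows "bij_betw (coordinate \<alpha>) {..<CARD('a)} UNIV"
proof -
  let ?n = "CARD('a) - 1"
  have "bij_betw (coordinate \<alpha>) ({..<?n} \<union> {?n}) ((UNIV - {0}) \<union> {0})"
  proof (rule bij_betw_combine)
    show "bij_betw (coordinate \<alpha>) {..<?n} (UNIV - {0})"
      using bij_betw_generator_power[OF assms]
      by (rule bij_betw_cong[THEN iffD1, rotated]) (simp add: coordinate_def)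
  qed (auto simp: bij_betw_def coordinate_def)
  moreover have "{..<?n} \<union> {?n} = {..<CARD('a)}"
    using zero_less_card_finite[where ?'a = 'a] by auto
  ultimately show ?thesis
    by simp
qed

lemma sum_coordinate:
  fixes \<alpha> :: "'a::{field,finite}"
  assumes "finite S" and "f 0 = 0"
  shows "(\<Sum>i\<in>S. f (coordinate \<alpha> i)) = (\<Sum>i\<in>S \<inter> {..<CARD('a) - 1}. f (\<alpha> ^ i))"
  by (rule sum.mono_neutral_cong_right) (use assms in \<open>auto simp: coordinate_def\<close>)

context gold
begin

lemma coordinate_image_mem_zero_sum_sets_iff:
  assumes "range (\<lambda>i::nat. \<alpha> ^ i) = UNIV - {0::'a}" and "S \<subseteq> {0..<2 ^ m}"
  shows "coordinate \<alpha> ` S \<in> zero_sum_sets gold_fun k \<longleftrightarrow> card S = k \<and>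
    (\<Sum>i\<in>S \<inter> {..<2 ^ m - 1}. \<alpha> ^ i) = 0 \<and>
    (\<Sum>i\<in>S \<inter> {..<2 ^ m - 1}. (\<alpha> ^ (1 + 2 ^ e)) ^ i) = 0"
proof -
  have inj: "inj_on (coordinate \<alpha>) S"
    using bij_betw_imp_inj_on[OF bij_betw_coordinate[OF assms(1)]]
    by (rule inj_on_subset) (use assms(2) in \<open>simp add: CARD_eq atLeast0LessThan\<close>)
  have "finite S"
    using assms(2) by (rule finite_subset) simp
  then have sums: "(\<Sum>i\<in>S. f (coordinate \<alpha> i)) = (\<Sum>i\<in>S \<inter> {..<2 ^ m - 1}. f (\<alpha> ^ i))"
    if "f 0 = 0" for f :: "'a \<Rightarrow> 'a"
    unfolding CARD_eq[symmetric] using that by (rule sum_coordinate)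
  have "gold_fun (\<alpha> ^ i) = (\<alpha> ^ (1 + 2 ^ e)) ^ i" for i
    by (simp only: gold_fun_def power_mult[symmetric] mult.commute)
  then show ?thesis
    by (simp only: zero_sum_sets_def mem_Collect_eq card_image[OF inj] sum.reindex[OF inj] comp_def
        sums[of gold_fun, OF gold_fun_0] sums[of "\<lambda>x. x", OF refl])
qed

lemma supports_extended_gold_code:
  assumes generator: "range (\<lambda>i::nat. \<alpha> ^ i) = UNIV - {0::'a}" and "even k"
  shows "{support c | c. c \<in> extended_code
       (cyclic_code (2 ^ m - 1) (lcm (min_poly2 \<alpha>) (min_poly2 (\<alpha> ^ (1 + 2 ^ e))))) \<and>
       hamming_weight c = k} =
     {S. S \<subseteq> {0..<2 ^ m} \<and> coordinate \<alpha> ` S \<in> zero_sum_sets gold_fun k}" (is "?L = ?R")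
proof -
  let ?n = "2 ^ m - 1 :: nat"
  let ?C = "cyclic_code ?n (lcm (min_poly2 \<alpha>) (min_poly2 (\<alpha> ^ (1 + 2 ^ e))))"
  have "\<alpha> \<noteq> 0" "\<alpha> ^ (1 + 2 ^ e) \<noteq> 0"
    using generator_nonzero[OF generator] by simp_all
  note roots = this[THEN power_two_power_m_minus_one]
  have "{..?n} = {0..<2 ^ m}"
    by (simp add: atLeast0LessThan flip: lessThan_Suc_atMost)
  moreover have "length c = ?n" if "c \<in> ?C" for c
    using that by (simp add: cyclic_code_def)
  ultimately have supports: "support ` extended_code ?C =
      {S. S \<subseteq> {0..<2 ^ m} \<and> even (card S) \<and> S \<inter> {..<?n} \<in> support ` ?C}"
    by (simp only: support_image_extended_code)
  have "?L = {S \<in> support ` extended_code ?C. card S = k}"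
    unfolding hamming_weight_def by blast
  also have "\<dots> = {S. S \<subseteq> {0..<2 ^ m} \<and> card S = k \<and>
      (\<Sum>i\<in>S \<inter> {..<?n}. \<alpha> ^ i) = 0 \<and> (\<Sum>i\<in>S \<inter> {..<?n}. (\<alpha> ^ (1 + 2 ^ e)) ^ i) = 0}"
    unfolding supports support_image_cyclic_code_lcm_min_poly2[OF roots] using assms(2) by blast
  also have "\<dots> = ?R"
    using coordinate_image_mem_zero_sum_sets_iff[OF generator, where k = k] by blast
  finally show ?thesis .
qed

end

theorem theorem3p10:
  fixes \<alpha> :: "'a::{field,finite}" and m e :: nat and C_E :: "bit list set"
  assumes "m > 0" and "[m = 0] (mod 4)"
    and "2 \<le> e" and "e \<le> m div 2" and "gcd m e = 2"
    and "CARD('a) = 2 ^ m"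
    and "range (\<lambda>i::nat. \<alpha> ^ i) = UNIV - {0}"
    and "C_E = cyclic_code (2 ^ m - 1) (lcm (min_poly2 \<alpha>) (min_poly2 (\<alpha> ^ (1 + 2 ^ e))))"
  shows "\<exists>l::nat.
      real l = (2 ^ (4 * m - 4) - 27 * 2 ^ (3 * m - 4) + 23 * 2 ^ (2 * m - 1)
                 + 261 * 2 ^ (m - 2) + 403) / 45 \<and>
      two_design {0..<2 ^ m} {support c | c. c \<in> extended_code C_E \<and> hamming_weight c = 8}
        (2 ^ m) 8 l"
proof -
  interpret gold m "TYPE('a)" e
    by unfold_locales (use assms in auto)
  have "4 dvd m"
    using assms(2) by (simp add: cong_0_iff)
  obtain l where design: "two_design UNIV (zero_sum_sets gold_fun 8) (2 ^ m) 8 l"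
    using exists_two_design_zero_sum_sets[of 8] by auto
  have "two_design {0..<2 ^ m}
      {S. S \<subseteq> {0..<2 ^ m} \<and> coordinate \<alpha> ` S \<in> zero_sum_sets gold_fun 8} (2 ^ m) 8 l"
    using bij_betw_coordinate[OF assms(7)] design
    by (intro two_design_vimage) (simp_all add: CARD_eq atLeast0LessThan)
  then have "two_design {0..<2 ^ m}
      {support c | c. c \<in> extended_code C_E \<and> hamming_weight c = 8} (2 ^ m) 8 l"
    unfolding assms(8) by (subst supports_extended_gold_code[OF assms(7)]) simp_all
  moreover note two_design_gold_8_index_real[OF design \<open>4 dvd m\<close> assms(5)]
  ultimately show ?thesis
    by blast
qed

end
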